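(* Let $d\geq 1$ be an integer. (1) Let $\sigma$ be any sign pattern of length $d+1$ with exactly $c=1$ sign change. Then for every integer $k$ with $0\leq k\leq [(d-1)/2]$, $\sigma$ is realizable with the admissible pair $(1,d-1-2k)$. (2) Let $\sigma$ be any sign pattern of length $d+1$, with $c$ sign changes and $p=d-c$ sign preservations. Then $\sigma$ is realizable with the admissible pair $(c,p)$.
   Context: A sign pattern of length $d+1$ is a sequence of $d+1$ signs $+$ or $-$ beginning with a $+$. A real polynomial $P=x^d+a_{d-1}x^{d-1}+\cdots+a_1x+a_0$ with all $a_j\neq 0$ defines the sign pattern $(+,\mathrm{sgn}(a_{d-1}),\ldots,\mathrm{sgn}(a_1),\mathrm{sgn}(a_0))$. For a sign pattern, $c$ denotes the number of sign changes (pairs of consecutive different signs) and $p$ the number of sign preservations (pairs of consecutive equal signs), so $c+p=d$. A pair $(pos,neg)$ of nonnegative integers is admissible for the sign pattern if $pos\leq c$, $neg\leq p$, $c-pos$ and $p-neg$ are even (possibly $0$), and $(-1)^{pos}$ equals the last sign of the pattern. A sign pattern is realizable with an admissible pair $(pos,neg)$ if there is a monic real polynomial of degree $d$ defining this sign pattern which has exactly $pos$ positive roots, all distinct (simple), and exactly $neg$ negative roots, all distinct (simple); the remaining roots are non-real. $[\alpha]$ denotes the integer part of $\alpha\in\mathbb{R}$. *)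

theory Defs
  imports Complex_Main "HOL-Computational_Algebra.Polynomial"
begin

text \<open>A sign is one of the reals 1 and -1, so that it can be compared with the library's \<open>sgn\<close>.\<close>

definition sign_pattern :: "nat \<Rightarrow> real list \<Rightarrow> bool" where
  "sign_pattern d \<sigma> \<longleftrightarrow> length \<sigma> = d + 1 \<and> set \<sigma> \<subseteq> {1, -1} \<and> hd \<sigma> = 1"

definition sign_changes :: "real list \<Rightarrow> nat" where
  "sign_changes \<sigma> = card {i. Suc i < length \<sigma> \<and> \<sigma> ! i \<noteq> \<sigma> ! Suc i}"

definition sign_preservations :: "real list \<Rightarrow> nat" where
  "sign_preservations \<sigma> = card {i. Suc i < length \<sigma> \<and> \<sigma> ! i = \<sigma> ! Suc i}"

definition admissible :: "real list \<Rightarrow> nat \<Rightarrow> nat \<Rightarrow> bool" where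
  "admissible \<sigma> pos neg \<longleftrightarrow>
     pos \<le> sign_changes \<sigma> \<and> neg \<le> sign_preservations \<sigma> \<and>
     even (sign_changes \<sigma> - pos) \<and> even (sign_preservations \<sigma> - neg) \<and>
     (-1) ^ pos = last \<sigma>"

text \<open>The library lists coefficients from the constant term upwards; sign patterns start at the
  leading one.\<close>

definition defines_sign_pattern :: "real poly \<Rightarrow> real list \<Rightarrow> bool" where
  "defines_sign_pattern P \<sigma> \<longleftrightarrow>
     (\<forall>j\<le>degree P. coeff P j \<noteq> 0) \<and> map sgn (rev (coeffs P)) = \<sigma>"

text \<open>The constant term is nonzero, so every real root is positive or negative; the condition on
  \<open>order\<close> says that all real roots are simple, and the remaining complex roots are non-real
  automatically.\<close>

definition realizable :: "nat \<Rightarrow> real list \<Rightarrow> nat \<Rightarrow> nat \<Rightarrow> bool" where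
  "realizable d \<sigma> pos neg \<longleftrightarrow> admissible \<sigma> pos neg \<and>
     (\<exists>P :: real poly. degree P = d \<and> lead_coeff P = 1 \<and> defines_sign_pattern P \<sigma> \<and>
        card {x. x > 0 \<and> poly P x = 0} = pos \<and>
        card {x. x < 0 \<and> poly P x = 0} = neg \<and>
        (\<forall>x. poly P x = 0 \<longrightarrow> order x P = 1))"

end

theory Submission
  imports Defs
begin

text \<open>Sign patterns can be concatenated: if \<open>P\<close> and \<open>Q\<close> define patterns \<open>\<sigma>\<close> and \<open>\<tau>\<close>, then
  \<open>P(x) \<epsilon>\<^sup>e Q(x/\<epsilon>)\<close> with \<open>e = degree Q\<close> and small \<open>\<epsilon> > 0\<close> defines \<open>\<sigma>\<close> followed by the tail of
  \<open>\<tau>\<close> times the last sign of \<open>\<sigma>\<close>, and the numbers of positive and negative roots add up. All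
  patterns needed are glued from \<open>x + 1\<close> and \<open>x - 1\<close>, together with \<open>x\<^sup>2 + x + 1\<close>, which
  contributes two preservations without real roots. The latter does not suffice when there is a
  single sign change, no negative root is wanted, and both blocks of equal signs have even length;
  there a cubic with pattern \<open>(+,+,-,-)\<close> and only one real root is put in the middle.\<close>

text \<open>Degree and admissibility are left out, so that blocks can be glued freely;
  \<open>realizable_iff\<close> restores both. Simplicity of roots is put as
  \<open>rsquarefree\<close>, which can be tested on the derivative of a product.\<close>

definition realizes :: "real poly \<Rightarrow> real list \<Rightarrow> nat \<Rightarrow> nat \<Rightarrow> bool" where
  "realizes P \<sigma> pos neg \<longleftrightarrow> lead_coeff P = 1 \<and> defines_sign_pattern P \<sigma> \<and>
     card {x. x > 0 \<and> poly P x = 0} = pos \<and> card {x. x < 0 \<and> poly P x = 0} = neg \<and> rsquarefree P"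

text \<open>The entrywise form needed to compare patterns coefficient by coefficient. Patterns start
  at the leading term, hence the reversed index; \<open>P \<noteq> 0\<close> matters because
  \<open>coeffs 0\<close> is empty.\<close>

lemma defines_sign_pattern_iff:
  "P \<noteq> 0 \<Longrightarrow> defines_sign_pattern P \<sigma> \<longleftrightarrow>
     length \<sigma> = degree P + 1 \<and> (\<forall>j\<le>degree P. coeff P j \<noteq> 0 \<and> \<sigma> ! (degree P - j) = sgn (coeff P j))"
  (is "?nz \<Longrightarrow> ?l \<longleftrightarrow> ?r")
proof -
  assume nz: ?nz
  have len: "length (coeffs P) = degree P + 1" using nz by (simp add: length_coeffs_degree)
  have nth: "map sgn (rev (coeffs P)) ! i = sgn (coeff P (degree P - i))" if "i \<le> degree P" for i
    using that len nz by (simp add: rev_nth coeffs_nth)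
  show ?thesis
  proof
    assume l: ?l
    then have s: "\<sigma> = map sgn (rev (coeffs P))" by (simp add: defines_sign_pattern_def)
    have "\<sigma> ! (degree P - j) = sgn (coeff P j)" if "j \<le> degree P" for j
      using nth[of "degree P - j"] that by (simp add: s)
    then show ?r using l len s by (auto simp: defines_sign_pattern_def)
  next
    assume r: ?r
    have "map sgn (rev (coeffs P)) = \<sigma>"
    proof (rule nth_equalityI)
      show "length (map sgn (rev (coeffs P))) = length \<sigma>" using r len by simp
      fix i assume "i < length (map sgn (rev (coeffs P)))"
      then have i: "i \<le> degree P" using len by simp
      have "\<sigma> ! (degree P - (degree P - i)) = sgn (coeff P (degree P - i))"
        using r by simp
      then show "map sgn (rev (coeffs P)) ! i = \<sigma> ! i" using i nth[OF i] by simp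
    qed
    then show ?l using r by (simp add: defines_sign_pattern_def)
  qed
qed

section \<open>Gluing by scaling the roots of one factor\<close>

text \<open>Its roots are those of \<open>Q\<close> multiplied by \<epsilon>; the power in front
  keeps the leading coefficient unchanged.\<close>

definition dilate :: "real \<Rightarrow> real poly \<Rightarrow> real poly" where
  "dilate \<epsilon> Q = smult (\<epsilon> ^ degree Q) (pcompose Q [:0, 1/\<epsilon>:])"

lemma coeff_dilate:
  assumes "\<epsilon> \<noteq> 0" "j \<le> degree Q"
  shows "coeff (dilate \<epsilon> Q) j = coeff Q j * \<epsilon> ^ (degree Q - j)"
  using assms by (simp add: dilate_def coeff_pcompose_linear power_diff power_one_over field_simps)

lemma degree_dilate: "\<epsilon> \<noteq> 0 \<Longrightarrow> degree (dilate \<epsilon> Q) = degree Q"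
  by (simp add: dilate_def degree_pcompose)

lemma poly_dilate: "poly (dilate \<epsilon> Q) x = \<epsilon> ^ degree Q * poly Q (x / \<epsilon>)"
  by (simp add: dilate_def poly_pcompose)

lemma poly_pderiv_dilate:
  "poly (pderiv (dilate \<epsilon> Q)) x = \<epsilon> ^ degree Q * (poly (pderiv Q) (x / \<epsilon>) / \<epsilon>)"
  by (simp add: dilate_def pderiv_smult pderiv_pcompose poly_pcompose pderiv_pCons)

text \<open>Taking out the lowest power of \<epsilon> leaves a sum in which only the term
  \<open>j = m\<close> is free of \<epsilon>.\<close>

lemma coeff_mult_dilate:
  fixes P Q :: "real poly" and n :: nat
  assumes "\<epsilon> \<noteq> 0"
  defines "m \<equiv> min n (degree Q)"
  shows "coeff (P * dilate \<epsilon> Q) n =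
    \<epsilon> ^ (degree Q - m) * (\<Sum>j\<le>m. coeff P (n - j) * coeff Q j * \<epsilon> ^ (m - j))"
proof -
  have "coeff (P * dilate \<epsilon> Q) n = (\<Sum>j\<le>n. coeff (dilate \<epsilon> Q) j * coeff P (n - j))"
    by (simp add: coeff_mult mult.commute[of P])
  also have "\<dots> = (\<Sum>j\<le>m. coeff (dilate \<epsilon> Q) j * coeff P (n - j))"
    by (rule sum.mono_neutral_right)
       (auto simp: m_def coeff_eq_0 degree_dilate[OF assms(1)])
  also have "\<dots> = (\<Sum>j\<le>m. \<epsilon> ^ (degree Q - m) * (coeff P (n - j) * coeff Q j * \<epsilon> ^ (m - j)))"
  proof (rule sum.cong)
    fix j assume "j \<in> {..m}"
    then have j: "j \<le> m" "m \<le> degree Q" by (auto simp: m_def)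
    then have "degree Q - j = (degree Q - m) + (m - j)" by simp
    then have "\<epsilon> ^ (degree Q - j) = \<epsilon> ^ (degree Q - m) * \<epsilon> ^ (m - j)"
      by (metis power_add)
    then show "coeff (dilate \<epsilon> Q) j * coeff P (n - j)
      = \<epsilon> ^ (degree Q - m) * (coeff P (n - j) * coeff Q j * \<epsilon> ^ (m - j))"
      using j by (simp add: coeff_dilate[OF assms(1)])
  qed simp
  finally show ?thesis by (simp add: sum_distrib_left)
qed

lemma eventually_sgn_coeff_mult_dilate:
  assumes "coeff P (n - min n (degree Q)) * coeff Q (min n (degree Q)) \<noteq> 0"
  shows "\<forall>\<^sub>F \<epsilon> in at_right 0. sgn (coeff (P * dilate \<epsilon> Q) n) =
    sgn (coeff P (n - min n (degree Q)) * coeff Q (min n (degree Q)))"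
proof -
  define m where "m = min n (degree Q)"
  define g :: "real \<Rightarrow> real" where "g \<epsilon> = (\<Sum>j\<le>m. coeff P (n - j) * coeff Q j * \<epsilon> ^ (m - j))" for \<epsilon>
  \<comment> \<open>Since \<open>0 ^ 0 = 1\<close>, the term \<open>j = m\<close> survives at 0 and
    all others vanish.\<close>
  have "g 0 = (\<Sum>j\<le>m. if j = m then coeff P (n - m) * coeff Q m else 0)"
    unfolding g_def by (rule sum.cong) (auto simp: power_0_left)
  then have g0: "g 0 = coeff P (n - m) * coeff Q m" by simp
  have "(g \<longlongrightarrow> g 0) (at_right 0)"
    unfolding g_def by (intro tendsto_intros)
  moreover have nz: "g 0 \<noteq> 0" using assms g0 m_def by simp
  \<comment> \<open>Multiplying by \<open>sgn (g 0)\<close> treats both signs of \<open>g 0\<close>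
    at once: the limit is positive in either case.\<close>
  ultimately have "((\<lambda>\<epsilon>. sgn (g \<epsilon>) * sgn (g 0)) \<longlongrightarrow> sgn (g 0) * sgn (g 0)) (at_right 0)"
    by (intro tendsto_intros)
  moreover have "0 < sgn (g 0) * sgn (g 0)" using nz by (simp add: sgn_if)
  ultimately have "\<forall>\<^sub>F \<epsilon> in at_right 0. sgn (g \<epsilon>) * sgn (g 0) > 0"
    by (rule order_tendstoD)
  moreover have "\<forall>\<^sub>F \<epsilon> in at_right 0. \<epsilon> > (0::real)"
    by (rule eventually_at_right_less)
  ultimately have "\<forall>\<^sub>F \<epsilon> in at_right 0. sgn (coeff (P * dilate \<epsilon> Q) n) = sgn (g 0)"
  proof eventually_elim
    case (elim \<epsilon>)
    then have "sgn (g \<epsilon>) = sgn (g 0)" by (auto simp: sgn_if split: if_splits)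
    moreover have "coeff (P * dilate \<epsilon> Q) n = \<epsilon> ^ (degree Q - m) * g \<epsilon>"
      using elim coeff_mult_dilate[of \<epsilon> P Q n] by (simp add: g_def m_def)
    ultimately show ?case using elim by (simp add: sgn_mult)
  qed
  then show ?thesis by (simp add: g0 m_def)
qed

text \<open>For small \<open>\<epsilon>\<close>, the coefficient of \<open>x\<^sup>n\<close> is dominated by the product of the coefficients of
  \<open>P\<close> at \<open>n - e\<close> and of \<open>Q\<close> at \<open>e\<close> if \<open>n \<ge> e\<close>, and of those of \<open>P\<close> at \<open>0\<close> and of \<open>Q\<close> at
  \<open>n\<close> otherwise.\<close>

lemma realizes_concat:
  assumes P: "realizes P \<sigma> a b" and Q: "realizes Q \<tau> a' b'"
  shows "\<exists>R. realizes R (\<sigma> @ map ((*) (last \<sigma>)) (tl \<tau>)) (a + a') (b + b')"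
proof -
  define D where "D = degree P"
  define e where "e = degree Q"
  have nz: "P \<noteq> 0" "Q \<noteq> 0" using P Q by (auto simp: realizes_def)
  have lc: "coeff P D = 1" "coeff Q e = 1" using P Q by (auto simp: realizes_def D_def e_def)
  have s: "length \<sigma> = D + 1" "\<And>j. j \<le> D \<Longrightarrow> coeff P j \<noteq> 0" 
      "\<And>j. j \<le> D \<Longrightarrow> \<sigma> ! (D - j) = sgn (coeff P j)"
    using P nz by (auto simp: realizes_def defines_sign_pattern_iff D_def)
  have t: "length \<tau> = e + 1" "\<And>j. j \<le> e \<Longrightarrow> coeff Q j \<noteq> 0" 
      "\<And>j. j \<le> e \<Longrightarrow> \<tau> ! (e - j) = sgn (coeff Q j)"
    using Q nz by (auto simp: realizes_def defines_sign_pattern_iff e_def)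
  have last: "last \<sigma> = sgn (coeff P 0)"
    using s(1) s(3)[of 0] by (cases \<sigma> rule: rev_cases) (auto simp: nth_append)
  have fin: "finite {x. poly P x = 0}" "finite {x. poly Q x = 0}"
    using nz by (auto intro: poly_roots_finite)
  have "\<forall>\<^sub>F \<epsilon> in at_right 0. \<forall>n\<in>{..D + e}. sgn (coeff (P * dilate \<epsilon> Q) n) =
    sgn (coeff P (n - min n e) * coeff Q (min n e))"
    unfolding e_def
    by (intro eventually_ball_finite ballI eventually_sgn_coeff_mult_dilate)
       (auto simp: e_def[symmetric] intro!: s t)
  \<comment> \<open>The constant term of \<open>P\<close> is nonzero, so the scaled roots of
    \<open>Q\<close>, which tend to 0, eventually avoid the roots of \<open>P\<close>.\<close>
  moreover have "\<forall>\<^sub>F \<epsilon> in at_right 0. \<forall>x\<in>{x. poly Q x = 0}. poly P (\<epsilon> * x) \<noteq> 0"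
  proof (intro eventually_ball_finite ballI fin)
    fix x
    have "((\<lambda>\<epsilon>. poly P (\<epsilon> * x)) \<longlongrightarrow> poly P (0 * x)) (at_right 0)"
      by (intro tendsto_intros)
    moreover have "poly P (0 * x) \<noteq> 0" using s(2)[of 0] by (simp add: poly_0_coeff_0)
    ultimately show "\<forall>\<^sub>F \<epsilon> in at_right 0. poly P (\<epsilon> * x) \<noteq> 0"
      by (rule tendsto_imp_eventually_ne)
  qed
  moreover have "\<forall>\<^sub>F \<epsilon> in at_right 0. \<epsilon> > (0::real)"
    by (rule eventually_at_right_less)
  ultimately have "\<forall>\<^sub>F \<epsilon> in at_right (0::real). \<epsilon> > 0 \<and> (\<forall>x\<in>{x. poly Q x = 0}. poly P (\<epsilon> * x) \<noteq> 0) \<and>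
     (\<forall>n\<in>{..D + e}. sgn (coeff (P * dilate \<epsilon> Q) n) = sgn (coeff P (n - min n e) * coeff Q (min n e)))"
    by eventually_elim auto
  then obtain \<epsilon> :: real where \<epsilon>: "\<epsilon> > 0"
    and disj: "\<And>x. poly Q x = 0 \<Longrightarrow> poly P (\<epsilon> * x) \<noteq> 0"
    and sg: "\<And>n. n \<le> D + e \<Longrightarrow> sgn (coeff (P * dilate \<epsilon> Q) n) =
       sgn (coeff P (n - min n e) * coeff Q (min n e))"
    by (fastforce dest: eventually_happens'[OF trivial_limit_at_right_real])
  define R where "R = P * dilate \<epsilon> Q"
  have lcd: "coeff (dilate \<epsilon> Q) e = 1" using \<epsilon> lc by (simp add: coeff_dilate e_def)
  have dd: "degree (dilate \<epsilon> Q) = e" using \<epsilon> by (simp add: degree_dilate e_def)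
  have dnz: "dilate \<epsilon> Q \<noteq> 0" using lcd by auto
  have degR: "degree R = D + e" using nz dnz by (simp add: R_def degree_mult_eq dd D_def)
  have Rnz: "R \<noteq> 0" using nz dnz by (simp add: R_def)
  have lcR: "lead_coeff R = 1" using lc lcd by (simp add: R_def lead_coeff_mult dd D_def)
  have rootR: "poly R x = 0 \<longleftrightarrow> poly P x = 0 \<or> poly Q (x / \<epsilon>) = 0" for x
    using \<epsilon> by (simp add: R_def poly_dilate)
  have disj': "\<not> (poly P x = 0 \<and> poly Q (x / \<epsilon>) = 0)" for x
    using disj[of "x / \<epsilon>"] \<epsilon> by auto
  have pattern: "defines_sign_pattern R (\<sigma> @ map ((*) (last \<sigma>)) (tl \<tau>))"
    unfolding defines_sign_pattern_iff[OF Rnz] degR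
  proof (intro conjI allI impI)
    show "length (\<sigma> @ map ((*) (last \<sigma>)) (tl \<tau>)) = D + e + 1" using s(1) t(1) by simp
    fix n assume n: "n \<le> D + e"
    have sgn: "sgn (coeff R n) = sgn (coeff P (n - min n e)) * sgn (coeff Q (min n e))"
      using sg[OF n] by (simp add: R_def sgn_mult)
    have "coeff P (n - min n e) \<noteq> 0" "coeff Q (min n e) \<noteq> 0" using n by (auto intro!: s t)
    then show "coeff R n \<noteq> 0" using sgn by (metis mult_eq_0_iff sgn_0_0)
    \<comment> \<open>For \<open>n \<ge> e\<close> the factor from \<open>Q\<close> is its leading
      coefficient 1, which gives the entries of \<sigma>. For \<open>n < e\<close> the factor from
      \<open>P\<close> is its constant term, whose sign is \<open>last \<sigma>\<close>.\<close>
    show "(\<sigma> @ map ((*) (last \<sigma>)) (tl \<tau>)) ! (D + e - n) = sgn (coeff R n)"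
    proof (cases "n \<ge> e")
      case True
      then have "D - (n - e) = D + e - n" "D + e - n < Suc D" "min n e = e" using n by auto
      then show ?thesis using n s(1) s(3)[of "n - e"] sgn lc by (simp add: nth_append)
    next
      case False
      then have "D + e - n - (D + 1) = e - n - 1" "e - n - 1 < length (tl \<tau>)" "Suc (e - n - 1) = e - n"
        using t(1) by auto
      then show ?thesis using False s(1) t(3)[of n] sgn last
        by (simp add: nth_append min_def nth_tl)
    qed
  qed
  \<comment> \<open>Any property invariant under scaling by \<epsilon> will do; positivity and
    negativity are the two cases used.\<close>
  have card: "card {x. S x \<and> poly R x = 0} =
      card {x. S x \<and> poly P x = 0} + card {x. S x \<and> poly Q x = 0}"
    if S: "\<And>x. S (\<epsilon> * x) \<longleftrightarrow> S x" for S
  proof -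
    have "{x. S x \<and> poly R x = 0} = {x. S x \<and> poly P x = 0} \<union> {x. S x \<and> poly Q (x / \<epsilon>) = 0}"
      by (auto simp: rootR)
    moreover have "{x. S x \<and> poly Q (x / \<epsilon>) = 0} = (*) \<epsilon> ` {x. S x \<and> poly Q x = 0}" (is "?A = _")
    proof (intro equalityI subsetI)
      fix x assume "x \<in> ?A"
      then show "x \<in> (*) \<epsilon> ` {x. S x \<and> poly Q x = 0}"
        using \<epsilon> S[of "x / \<epsilon>"] by (intro image_eqI[of _ _ "x / \<epsilon>"]) auto
    qed (use \<epsilon> S in auto)
    moreover have "card ((*) \<epsilon> ` {x. S x \<and> poly Q x = 0}) = card {x. S x \<and> poly Q x = 0}"
      using \<epsilon> by (intro card_image) (auto simp: inj_on_def)
    moreover have "finite {x. S x \<and> poly P x = 0}" "finite {x. S x \<and> poly Q x = 0}"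
      by (rule finite_subset[OF _ fin(1)] finite_subset[OF _ fin(2)]; auto)+
    moreover have "{x. S x \<and> poly P x = 0} \<inter> {x. S x \<and> poly Q (x / \<epsilon>) = 0} = {}"
      using disj' by auto
    ultimately show ?thesis by (simp add: card_Un_disjoint)
  qed
  have "rsquarefree R" unfolding rsquarefree_roots
  proof (intro allI notI, elim conjE)
    fix x assume 1: "poly R x = 0" and 2: "poly (pderiv R) x = 0"
    have P': "\<not> (poly P x = 0 \<and> poly (pderiv P) x = 0)"
      and Q': "\<not> (poly Q (x / \<epsilon>) = 0 \<and> poly (pderiv Q) (x / \<epsilon>) = 0)"
      using P Q by (auto simp: realizes_def rsquarefree_roots)
    \<comment> \<open>Exactly one factor vanishes at \<open>x\<close>, so one summand of the product
      rule drops out and the other forces a multiple root of that factor.\<close>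
    have "poly (pderiv R) x = \<epsilon> ^ e *
        (poly (pderiv P) x * poly Q (x / \<epsilon>) + poly P x * (poly (pderiv Q) (x / \<epsilon>) / \<epsilon>))"
      by (simp add: R_def e_def pderiv_mult poly_dilate poly_pderiv_dilate distrib_left ac_simps)
    with 2 \<epsilon> have "poly (pderiv P) x * poly Q (x / \<epsilon>) + poly P x * (poly (pderiv Q) (x / \<epsilon>) / \<epsilon>) = 0"
      by simp
    with 1 disj'[of x] P' Q' \<epsilon> show False by (auto simp: rootR)
  qed
  moreover have "card {x. x > 0 \<and> poly R x = 0} = a + a'" "card {x. x < 0 \<and> poly R x = 0} = b + b'"
    using card[of "\<lambda>x. x > 0"] card[of "\<lambda>x. x < 0"] P Q \<epsilon>
    by (simp_all add: realizes_def zero_less_mult_iff mult_less_0_iff)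
  ultimately show ?thesis using lcR pattern by (auto simp: realizes_def)
qed

section \<open>Building blocks\<close>

lemma realizes_one: "realizes 1 [1] 0 0"
  by (simp add: realizes_def defines_sign_pattern_def rsquarefree_roots)

lemma realizes_preservation: "realizes [:1, 1:] [1, 1] 0 1"
proof -
  have neg: "{x::real. x < 0 \<and> 1 + x = 0} = {-1}" and pos: "{x::real. x > 0 \<and> 1 + x = 0} = {}"
    by auto
  show ?thesis
    by (simp add: realizes_def defines_sign_pattern_def rsquarefree_roots pderiv_pCons le_Suc_eq
        neg pos del: Collect_empty_eq)
qed

lemma realizes_change: "realizes [:-1, 1:] [1, -1] 1 0"
proof -
  have "{x::real. x > 0 \<and> x = 1} = {1}" "{x::real. x < 0 \<and> x = 1} = {}" by auto
  then show ?thesis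
    by (simp add: realizes_def defines_sign_pattern_def rsquarefree_roots pderiv_pCons le_Suc_eq)
qed

lemma realizes_two_preservations: "realizes [:1, 1, 1:] [1, 1, 1] 0 0"
proof -
  have "1 + x * (1 + x) \<noteq> 0" for x :: real
  proof -
    have "1 + x * (1 + x) = (x + 1/2)\<^sup>2 + 3/4" by (simp add: power2_eq_square field_simps)
    then show ?thesis by (smt (verit) zero_le_power2 zero_less_divide_iff)
  qed
  then show ?thesis
    by (simp add: realizes_def defines_sign_pattern_def rsquarefree_roots le_Suc_eq numeral_2_eq_2)
qed

text \<open>The polynomial is \<open>(x - 1)(x\<^sup>2 + 2x + 3/2)\<close>.\<close>

lemma realizes_change_between_preservations:
  "realizes [:-3/2, -1/2, 1, 1:] [1, 1, -1, -1] 1 0"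
proof -
  define P :: "real poly" where "P = [:-3/2, -1/2, 1, 1:]"
  have root: "poly P x = 0 \<longleftrightarrow> x = 1" for x
  proof -
    have "poly P x = (x - 1) * ((x + 1)\<^sup>2 + 1/2)"
      by (simp add: P_def power2_eq_square field_simps)
    moreover have "(x + 1)\<^sup>2 + 1/2 \<noteq> 0" by (smt (verit) zero_le_power2 zero_less_divide_iff)
    ultimately show ?thesis by simp
  qed
  have "{x::real. x > 0 \<and> x = 1} = {1}" "{x::real. x < 0 \<and> x = 1} = {}" by auto
  moreover have "rsquarefree P"
    unfolding rsquarefree_roots root by (simp add: P_def pderiv_pCons)
  moreover have "lead_coeff P = 1" "defines_sign_pattern P [1, 1, -1, -1]"
    by (auto simp: P_def defines_sign_pattern_def le_Suc_eq numeral_3_eq_3)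
  ultimately have "realizes P [1, 1, -1, -1] 1 0" by (simp add: realizes_def root)
  then show ?thesis by (simp add: P_def)
qed

section \<open>Counting changes and preservations\<close>

lemma sign_changes_singleton [simp]: "sign_changes [s] = 0" "sign_preservations [s] = 0"
  by (simp_all add: sign_changes_def sign_preservations_def)

lemma sign_changes_snoc:
  assumes "\<sigma> \<noteq> []"
  shows "sign_changes (\<sigma> @ [s]) = sign_changes \<sigma> + (if last \<sigma> = s then 0 else 1)"
    and "sign_preservations (\<sigma> @ [s]) = sign_preservations \<sigma> + (if last \<sigma> = s then 1 else 0)"
proof -
  define n where "n = length \<sigma> - 1"
  have len: "length \<sigma> = Suc n" using assms by (simp add: n_def)
  have last: "last \<sigma> = \<sigma> ! n" using assms by (simp add: n_def last_conv_nth)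
  \<comment> \<open>An arbitrary relation \<open>p\<close> covers changes and preservations in one
    argument.\<close>
  have *: "card {i. Suc i < length (\<sigma> @ [s]) \<and> p ((\<sigma> @ [s]) ! i) ((\<sigma> @ [s]) ! Suc i)} =
    card {i. Suc i < length \<sigma> \<and> p (\<sigma> ! i) (\<sigma> ! Suc i)} + (if p (last \<sigma>) s then 1 else 0)"
    for p :: "real \<Rightarrow> real \<Rightarrow> bool"
  proof -
    have "{i. Suc i < length (\<sigma> @ [s]) \<and> p ((\<sigma> @ [s]) ! i) ((\<sigma> @ [s]) ! Suc i)} =
      {i. Suc i < length \<sigma> \<and> p (\<sigma> ! i) (\<sigma> ! Suc i)} \<union> (if p (last \<sigma>) s then {n} else {})"
      by (auto simp: len last nth_append less_Suc_eq split: if_splits)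
    moreover have "finite {i. Suc i < length \<sigma> \<and> p (\<sigma> ! i) (\<sigma> ! Suc i)}"
      by (rule finite_subset[of _ "{..n}"]) (auto simp: len)
    ultimately show ?thesis by (auto simp: len)
  qed
  show "sign_changes (\<sigma> @ [s]) = sign_changes \<sigma> + (if last \<sigma> = s then 0 else 1)"
    using *[of "(\<noteq>)"] by (simp add: sign_changes_def)
  show "sign_preservations (\<sigma> @ [s]) = sign_preservations \<sigma> + (if last \<sigma> = s then 1 else 0)"
    using *[of "(=)"] by (simp add: sign_preservations_def)
qed

text \<open>Patterns grow at the end, because gluing appends entries there and leaves the initial 1
  in place.\<close>

lemma sign_pattern_induct [consumes 1, case_names Nil snoc]:
  assumes "sign_pattern d \<sigma>"
    and "Q 0 [1]"
    and "\<And>d \<sigma> s. sign_pattern d \<sigma> \<Longrightarrow> \<sigma> \<noteq> [] \<Longrightarrow> last \<sigma> \<in> {1, -1} \<Longrightarrow> s \<in> {1, -1} \<Longrightarrow> Q d \<sigma> \<Longrightarrow>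
      Q (Suc d) (\<sigma> @ [s])"
  shows "Q d \<sigma>"
  using assms(1)
proof (induction d arbitrary: \<sigma>)
  case 0
  then have "\<sigma> = [1]" by (cases \<sigma>) (auto simp: sign_pattern_def)
  then show ?case using assms(2) by simp
next
  case (Suc d)
  then obtain \<rho> s where \<sigma>: "\<sigma> = \<rho> @ [s]" by (cases \<sigma> rule: rev_cases) (auto simp: sign_pattern_def)
  then have ne: "\<rho> \<noteq> []"
    using Suc.prems by (auto simp: \<sigma> sign_pattern_def)
  then have \<rho>: "sign_pattern d \<rho>" and s: "s \<in> {1, -1}"
    using Suc.prems by (auto simp: \<sigma> sign_pattern_def hd_append)
  then have "last \<rho> \<in> {1, -1}" using last_in_set[OF ne] by (auto simp: sign_pattern_def)
  then show ?case unfolding \<sigma> using assms(3) \<rho> ne s Suc.IH by blast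
qed

text \<open>Each change flips the last sign and each preservation keeps it. These facts supply the
  admissibility of the pairs in the theorem.\<close>

lemma sign_pattern_counts:
  assumes "sign_pattern d \<sigma>"
  shows "sign_changes \<sigma> + sign_preservations \<sigma> = d" and "(-1) ^ sign_changes \<sigma> = last \<sigma>"
  using assms
  by (induction rule: sign_pattern_induct)
     (auto simp: sign_changes_snoc)

text \<open>The length of the pattern determines the degree, and for nonzero \<open>P\<close> being
  \<open>rsquarefree\<close> means that every real root has order 1.\<close>

lemma realizable_iff:
  assumes "sign_pattern d \<sigma>"
  shows "realizable d \<sigma> pos neg \<longleftrightarrow> admissible \<sigma> pos neg \<and> (\<exists>P. realizes P \<sigma> pos neg)"
proof -
  have deg: "degree P = d" if "realizes P \<sigma> pos neg" for P
  proof -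
    from that have "P \<noteq> 0" by (auto simp: realizes_def)
    then show ?thesis using that assms
      by (auto simp: realizes_def defines_sign_pattern_iff sign_pattern_def)
  qed
  have simple: "rsquarefree P \<longleftrightarrow> (\<forall>x. poly P x = 0 \<longrightarrow> order x P = 1)"
    if "lead_coeff P = 1" for P :: "real poly"
  proof -
    have "P \<noteq> 0" using that by auto
    then have "poly P x = 0 \<longleftrightarrow> order x P \<noteq> 0" for x by (simp add: order_root)
    with \<open>P \<noteq> 0\<close> show ?thesis unfolding rsquarefree_def by metis
  qed
  have "degree P = d \<and> lead_coeff P = 1 \<and> defines_sign_pattern P \<sigma> \<and>
        card {x. x > 0 \<and> poly P x = 0} = pos \<and> card {x. x < 0 \<and> poly P x = 0} = neg \<and>
        (\<forall>x. poly P x = 0 \<longrightarrow> order x P = 1) \<longleftrightarrow> realizes P \<sigma> pos neg" for P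
    using deg[of P] simple[of P] unfolding realizes_def by argo
  then show ?thesis unfolding realizable_def by presburger
qed

section \<open>Realizing the required pairs\<close>

text \<open>One linear factor is glued per new entry: \<open>x + 1\<close> for a preservation,
  adding a negative root, and \<open>x - 1\<close> for a change, adding a positive one.\<close>

lemma realizes_all_real:
  assumes "sign_pattern d \<sigma>"
  shows "\<exists>P. realizes P \<sigma> (sign_changes \<sigma>) (sign_preservations \<sigma>)"
  using assms
proof (induction rule: sign_pattern_induct)
  case Nil
  show ?case using realizes_one by auto
next
  case (snoc d \<sigma> s)
  then obtain P where P: "realizes P \<sigma> (sign_changes \<sigma>) (sign_preservations \<sigma>)" by blast
  show ?case
  proof (cases "last \<sigma> = s")
    case True
    then show ?thesis using realizes_concat[OF P realizes_preservation] snoc.hyps(2)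
      by (simp add: sign_changes_snoc)
  next
    case False
    then have "s = - last \<sigma>" using snoc.hyps by auto
    then show ?thesis using realizes_concat[OF P realizes_change] snoc.hyps(2) False
      by (simp add: sign_changes_snoc)
  qed
qed

text \<open>The first \<open>2 * k\<close> entries are added in pairs by the quadratic without real
  roots, the other \<open>r\<close> singly by \<open>x + 1\<close>.\<close>

lemma realizes_append_preservations:
  assumes "realizes P \<sigma> a b" and "last \<sigma> = s"
  shows "\<exists>R. realizes R (\<sigma> @ replicate (2 * k + r) s) a (b + r)"
proof (induction r)
  case 0
  show ?case
  proof (induction k)
    case 0
    show ?case using assms by auto
  next
    case (Suc k)
    then obtain R where R: "realizes R (\<sigma> @ replicate (2 * k) s) a b" by auto
    have "last (\<sigma> @ replicate (2 * k) s) = s" using assms(2) by (cases k) auto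
    moreover have "replicate (2 * Suc k + 0) s = replicate (2 * k) s @ [s, s]"
      by (simp add: replicate_app_Cons_same)
    ultimately show ?case using realizes_concat[OF R realizes_two_preservations] by simp
  qed
next
  case (Suc r)
  then obtain R where R: "realizes R (\<sigma> @ replicate (2 * k + r) s) a (b + r)" by auto
  have "last (\<sigma> @ replicate (2 * k + r) s) = s" using assms(2) by (cases "2 * k + r") auto
  then show ?case using realizes_concat[OF R realizes_preservation]
    by (simp add: replicate_append_same)
qed

text \<open>The case without changes feeds the other one, when the appended sign is the only
  change.\<close>

lemma sign_pattern_one_change:
  assumes "sign_pattern d \<sigma>"
  shows "sign_changes \<sigma> = 0 \<Longrightarrow> \<sigma> = replicate (Suc d) 1"
    and "sign_changes \<sigma> = 1 \<Longrightarrow>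
      \<exists>m n. m + n + 1 = d \<and> \<sigma> = replicate (Suc m) 1 @ replicate (Suc n) (-1)"
  using assms
proof (induction rule: sign_pattern_induct)
  case Nil
  case 1 show ?case by simp
next
  case Nil
  case 2 then show ?case by simp
next
  case (snoc d \<sigma> s)
  case 1
  then show ?case using snoc by (simp add: sign_changes_snoc replicate_append_same split: if_splits)
next
  case (snoc d \<sigma> s)
  case 2
  show ?case
  proof (cases "last \<sigma> = s")
    case True
    then have "sign_changes \<sigma> = 1" using 2 snoc by (simp add: sign_changes_snoc)
    then obtain m n where mn: "m + n + 1 = d" "\<sigma> = replicate (Suc m) 1 @ replicate (Suc n) (-1)"
      using snoc by blast
    then have "s = -1" using True by (simp del: replicate_Suc)
    then show ?thesis using mn
      by (intro exI[of _ m] exI[of _ "Suc n"]) (simp add: replicate_append_same)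
  next
    case False
    then have "sign_changes \<sigma> = 0" using 2 snoc by (simp add: sign_changes_snoc)
    then have \<sigma>: "\<sigma> = replicate (Suc d) 1" using snoc by blast
    then have "s = -1" using False snoc by (auto simp del: replicate_Suc)
    then show ?thesis using \<sigma> by (intro exI[of _ d] exI[of _ 0]) simp
  qed
qed

text \<open>Among the \<open>m + n\<close> preservations, \<open>k\<close> pairs must carry no real
  root. Pairs inside the two blocks suffice unless \<open>k\<close> exceeds
  \<open>m div 2 + n div 2\<close>.\<close>

lemma realizes_one_change:
  assumes "2 * k \<le> m + n"
  shows "\<exists>P. realizes P (replicate (Suc m) 1 @ replicate (Suc n) (-1)) 1 (m + n - 2 * k)"
proof (cases "k \<le> m div 2 + n div 2")
  case True
  \<comment> \<open>As many pairs as possible, up to \<open>k\<close>, are taken from the first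
    block; the remaining \<open>j\<close> fit into the second.\<close>
  define i where "i = min k (m div 2)"
  define r where "r = m - 2 * i"
  define j where "j = k - i"
  define t where "t = n - 2 * j"
  have m: "m = 2 * i + r" and n: "n = 2 * j + t" and rt: "m + n - 2 * k = r + t"
    using True by (auto simp: i_def r_def j_def t_def min_def)
  obtain A where A: "realizes A (replicate (Suc m) 1) 0 r"
    using realizes_append_preservations[OF realizes_one, of 1 i r] by (auto simp: m)
  obtain B where B: "realizes B (replicate (Suc m) 1 @ [-1]) 1 r"
    using realizes_concat[OF A realizes_change] by (auto simp del: replicate_Suc)
  show ?thesis
    using realizes_append_preservations[OF B, of "-1" j t] rt by (auto simp: n)
next
  case False
  \<comment> \<open>Only \<open>k = (m + n) / 2\<close> with \<open>m\<close> and \<open>n\<close>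
    odd is left. The cubic uses one preservation from each block, so an even number remains on
    either side.\<close>
  with assms have "odd m" "odd n" and k: "m + n - 2 * k = 0" by presburger+
  then obtain i j where m: "m = 2 * i + 1" and n: "n = 2 * j + 1" by (meson oddE)
  obtain A where A: "realizes A (replicate (Suc (2 * i)) 1) 0 0"
    using realizes_append_preservations[OF realizes_one, of 1 i 0] by auto
  obtain B where B: "realizes B (replicate (Suc (2 * i)) 1 @ [1, -1, -1]) 1 0"
    using realizes_concat[OF A realizes_change_between_preservations]
    by (auto simp del: replicate_Suc)
  have "replicate (Suc (2 * i)) 1 @ [1, -1, -1] @ replicate (2 * j) (-1) =
      replicate (Suc m) (1::real) @ replicate (Suc n) (-1)"
    by (simp add: m n replicate_app_Cons_same)
  then show ?thesis
    using realizes_append_preservations[OF B, of "-1" j 0] k by auto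
qed

theorem proposition1:
  fixes d :: nat
  assumes "d \<ge> 1"
  shows "(\<forall>\<sigma>. sign_pattern d \<sigma> \<and> sign_changes \<sigma> = 1 \<longrightarrow>
            (\<forall>k::nat. k \<le> (d - 1) div 2 \<longrightarrow> realizable d \<sigma> 1 (d - 1 - 2 * k))) \<and>
         (\<forall>\<sigma>. sign_pattern d \<sigma> \<longrightarrow>
            realizable d \<sigma> (sign_changes \<sigma>) (sign_preservations \<sigma>))"
proof (intro conjI allI impI, elim conjE)
  fix \<sigma> and k :: nat
  assume \<sigma>: "sign_pattern d \<sigma>" and c: "sign_changes \<sigma> = 1" and k: "k \<le> (d - 1) div 2"
  obtain m n where mn: "m + n + 1 = d" "\<sigma> = replicate (Suc m) 1 @ replicate (Suc n) (-1)"
    using sign_pattern_one_change(2)[OF \<sigma> c] by blast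
  have "\<exists>P. realizes P \<sigma> 1 (d - 1 - 2 * k)"
    using realizes_one_change[of k m n] k mn by auto
  \<comment> \<open>There are \<open>d - 1\<close> preservations, so the deficit in negative roots
    is \<open>2 * k\<close>.\<close>
  moreover have "admissible \<sigma> 1 (d - 1 - 2 * k)"
    using sign_pattern_counts[OF \<sigma>] c k by (auto simp: admissible_def)
  ultimately show "realizable d \<sigma> 1 (d - 1 - 2 * k)" by (simp add: realizable_iff[OF \<sigma>])
next
  fix \<sigma> assume \<sigma>: "sign_pattern d \<sigma>"
  show "realizable d \<sigma> (sign_changes \<sigma>) (sign_preservations \<sigma>)"
    using realizes_all_real[OF \<sigma>] sign_pattern_counts[OF \<sigma>]
    by (simp add: realizable_iff[OF \<sigma>] admissible_def)
qed

end
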